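(* Let $\psi(q)=\sum_{n=1}^\infty \frac{q^{n^2}}{(q;q^2)_n}$, and for $n\ge1$ let $p^o_{do}(n)$ denote the number of partitions of $n$ into an odd number of distinct parts with the smallest part being odd. Then \[ (-q;q)_\infty\,\psi(-q)=-\sum_{n\ge 1}p^o_{do}(n)q^n. \]
   Context: Notation: $(a;q)_n=(1-a)(1-aq)\cdots(1-aq^{n-1})$ and $(a;q)_\infty=\prod_{n\ge 0}(1-aq^n)$, $|q|<1$. *)

theory Defs
  imports "HOL-Analysis.Analysis" "HOL-Library.Multiset"
begin

definition qpoch :: "complex \<Rightarrow> complex \<Rightarrow> nat \<Rightarrow> complex" where
  "qpoch a q n = (\<Prod>k<n. 1 - a * q ^ k)"

definition qpoch_inf :: "complex \<Rightarrow> complex \<Rightarrow> complex" where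
  "qpoch_inf a q = (\<Prod>k. 1 - a * q ^ k)"

(* The series starts at exponent 1, hence the shift to Suc n. *)
definition mock_psi :: "complex \<Rightarrow> complex" where
  "mock_psi q = (\<Sum>n. q ^ (Suc n)\<^sup>2 / qpoch q (q\<^sup>2) (Suc n))"

definition partition_of :: "nat multiset \<Rightarrow> nat \<Rightarrow> bool" where
  "partition_of M n \<longleftrightarrow> 0 \<notin># M \<and> sum_mset M = n"

definition distinct_parts :: "nat multiset \<Rightarrow> bool" where
  "distinct_parts M \<longleftrightarrow> (\<forall>k. count M k \<le> 1)"

(* Min {} is unspecified, but odd (size M) excludes the empty partition. *)
definition p_do_odd :: "nat \<Rightarrow> nat" where
  "p_do_odd n = card {M. partition_of M n \<and> distinct_parts M \<and>
                         odd (size M) \<and> odd (Min (set_mset M))}"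

end

(* Put p = q^2 and E(x) = (x; p)_inf. Splitting a set of distinct parts at its smallest part, the
   partitions with odd smallest part, weighted by y^(number of parts), y = 1 or -1, have
   generating function y T_y(q), where T_y(z) = sum_j z p^j E(-y p^(j+1)) E(-y z p^(j+1)), so
   the right-hand side is -(T_1(q) + T_{-1}(q)) / 2. The left-hand side is -C(q), where
   C(z) = E(-p) sum_n (-1)^n p^(n(n+1)/2) z^(n+1) E(-z p^(n+1)). A telescoping sum gives
   y (T_y(z) + z T_y(zp)) = z (E(-y) E(-yzp) - 1), a shift of summation gives
   C(z) + z C(zp) = z E(-p) E(-zp), and E(-1) = 2 E(-p), E(1) = 0. Hence
   Y = T_1 + T_{-1} - 2 C satisfies Y(z) = -z Y(zp); being bounded, it vanishes for |z| < 1. *)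

theory Submission
  imports Defs
begin

section \<open>Infinite q-Pochhammer products\<close>

lemma convergent_prod_qpoch:
  fixes a q :: complex
  assumes "norm q < 1"
  shows "convergent_prod (\<lambda>k. 1 - a * q ^ k)"
proof -
  have "summable (\<lambda>k. norm (1 - a * q ^ k - 1))"
    using assms by (simp add: norm_mult norm_power summable_mult summable_geometric)
  then show ?thesis
    by (intro abs_convergent_prod_imp_convergent_prod summable_imp_abs_convergent_prod)
qed

lemma qpoch_inf_LIMSEQ:
  assumes "norm q < 1"
  shows "(\<lambda>n. qpoch a q n) \<longlonglongrightarrow> qpoch_inf a q"
  using convergent_prod_LIMSEQ[OF convergent_prod_qpoch[OF assms]]
  unfolding qpoch_def qpoch_inf_def by (simp add: LIMSEQ_lessThan_iff_atMost)

lemma qpoch_add: "qpoch a q (n + m) = qpoch a q n * qpoch (a * q ^ n) q m"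
proof (induction m)
  case (Suc m)
  have step: "qpoch b q (Suc k) = qpoch b q k * (1 - b * q ^ k)" for b k
    by (simp add: qpoch_def)
  show ?case
    unfolding add_Suc_right step Suc.IH power_add by (simp only: mult.assoc)
qed (simp add: qpoch_def)

lemma qpoch_inf_split:
  assumes "norm q < 1"
  shows "qpoch_inf a q = qpoch a q n * qpoch_inf (a * q ^ n) q"
proof (rule LIMSEQ_unique)
  show "(\<lambda>m. qpoch a q (n + m)) \<longlonglongrightarrow> qpoch_inf a q"
    using LIMSEQ_ignore_initial_segment[OF qpoch_inf_LIMSEQ[OF assms, of a], of n] by (simp add: add.commute)
  show "(\<lambda>m. qpoch a q (n + m)) \<longlonglongrightarrow> qpoch a q n * qpoch_inf (a * q ^ n) q"
    unfolding qpoch_add by (intro tendsto_intros qpoch_inf_LIMSEQ assms)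
qed

lemma qpoch_inf_step:
  assumes "norm q < 1"
  shows "qpoch_inf a q = (1 - a) * qpoch_inf (a * q) q"
  using qpoch_inf_split[OF assms, of a 1] by (simp add: qpoch_def)

text \<open>Sort the factors by the parity of their exponent and pass to the limit along the partial
  products of even length. This connects the base q of the problem with the base p = q^2 of the
  functional equations.\<close>

lemma qpoch_inf_even_odd:
  assumes "norm q < 1"
  shows "qpoch_inf a q = qpoch_inf a (q\<^sup>2) * qpoch_inf (a * q) (q\<^sup>2)"
proof (rule LIMSEQ_unique)
  have q2: "norm (q\<^sup>2) < 1"
    using assms by (simp add: norm_power power_less_one_iff)
  have eq: "qpoch a q (2 * n) = qpoch a (q\<^sup>2) n * qpoch (a * q) (q\<^sup>2) n" for n
    by (induction n) (simp_all add: qpoch_def power_mult[symmetric] mult_ac)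
  have "filterlim (\<lambda>n::nat. 2 * n) sequentially sequentially"
    by (intro filterlim_subseq) (auto simp: strict_mono_def)
  then show "(\<lambda>n. qpoch a q (2 * n)) \<longlonglongrightarrow> qpoch_inf a q"
    by (rule filterlim_compose[OF qpoch_inf_LIMSEQ[OF assms]])
  show "(\<lambda>n. qpoch a q (2 * n)) \<longlonglongrightarrow> qpoch_inf a (q\<^sup>2) * qpoch_inf (a * q) (q\<^sup>2)"
    unfolding eq by (intro tendsto_intros qpoch_inf_LIMSEQ q2)
qed

lemma qpoch_inf_nonzero:
  assumes "norm q < 1" "norm a < 1"
  shows "qpoch_inf a q \<noteq> 0"
  unfolding qpoch_inf_def
proof (rule prodinf_nonzero)
  show "convergent_prod (\<lambda>k. 1 - a * q ^ k)"
    by (rule convergent_prod_qpoch[OF assms(1)])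
  fix k
  have "norm (a * q ^ k) \<le> norm a * 1"
    unfolding norm_mult norm_power using assms by (intro mult_left_mono power_le_one) auto
  then show "1 - a * q ^ k \<noteq> 0"
    using assms(2) by auto
qed

text \<open>Replacing every term by its norm gives a product that is at most the exponential of a
  geometric series. The bound tends to 0 with a, which yields continuity at 0, and it is uniform on
  the unit disc.\<close>

lemma norm_qpoch_inf_minus_1_le:
  assumes "norm q < 1"
  shows "norm (qpoch_inf a q - 1) \<le> exp (norm a / (1 - norm q)) - 1"
proof (rule tendsto_upperbound)
  show "(\<lambda>n. norm (qpoch a q n - 1)) \<longlonglongrightarrow> norm (qpoch_inf a q - 1)"
    by (intro tendsto_intros qpoch_inf_LIMSEQ assms)
  have "norm (qpoch a q n - 1) \<le> exp (norm a / (1 - norm q)) - 1" for n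
  proof -
    have "norm (qpoch a q n - 1) \<le> (\<Prod>k<n. 1 + norm a * norm q ^ k) - 1"
      using norm_prod_minus1_le_prod_minus1[of "\<lambda>k. - (a * q ^ k)" "{..<n}"]
      by (simp add: qpoch_def norm_mult norm_power)
    also have "(\<Prod>k<n. 1 + norm a * norm q ^ k) \<le> exp (\<Sum>k<n. norm a * norm q ^ k)"
      by (intro prod_le_exp_sum) auto
    also have "(\<Sum>k<n. norm a * norm q ^ k) \<le> norm a * (1 / (1 - norm q))"
      unfolding sum_distrib_left[symmetric]
      using sum_le_suminf[of "\<lambda>k. norm q ^ k" "{..<n}"] assms
      by (intro mult_left_mono) (auto simp: suminf_geometric summable_geometric)
    finally show ?thesis by simp
  qed
  then show "\<forall>\<^sub>F n in sequentially. norm (qpoch a q n - 1) \<le> exp (norm a / (1 - norm q)) - 1"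
    by simp
qed simp

lemma norm_qpoch_inf_le:
  assumes "norm q < 1" "norm a \<le> 1"
  shows "norm (qpoch_inf a q) \<le> exp (1 / (1 - norm q))"
proof -
  have "norm (qpoch_inf a q) \<le> norm (qpoch_inf a q - 1) + 1"
    using norm_triangle_ineq[of "qpoch_inf a q - 1" 1] by simp
  also have "\<dots> \<le> exp (norm a / (1 - norm q))"
    using norm_qpoch_inf_minus_1_le[OF assms(1), of a] by simp
  also have "\<dots> \<le> exp (1 / (1 - norm q))"
    using assms by (simp add: divide_right_mono)
  finally show ?thesis .
qed

lemma qpoch_inf_tendsto_1:
  assumes "norm q < 1" "f \<longlonglongrightarrow> 0"
  shows "(\<lambda>n. qpoch_inf (f n) q) \<longlonglongrightarrow> 1"
proof -
  have "(\<lambda>n. exp (norm (f n) / (1 - norm q)) - 1) \<longlonglongrightarrow> exp (norm (0::complex) / (1 - norm q)) - 1"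
    by (intro tendsto_intros assms) (use assms in auto)
  then have lim: "(\<lambda>n. exp (norm (f n) / (1 - norm q)) - 1) \<longlonglongrightarrow> 0"
    by simp
  have "(\<lambda>n. qpoch_inf (f n) q - 1) \<longlonglongrightarrow> 0"
    by (rule Lim_null_comparison[OF _ lim], rule always_eventually, rule allI,
        rule norm_qpoch_inf_minus_1_le[OF assms(1)])
  then show ?thesis
    by (rule LIM_zero_cancel)
qed

section \<open>Two functional equations\<close>

text \<open>At p = q^2 and z = q the two products merge into one product in base q, and y times the
  j-th term generates the sets with smallest part 2j+1. Keeping z separate from p makes the shift z
  -> zp available.\<close>

definition odd_min_term :: "complex \<Rightarrow> complex \<Rightarrow> complex \<Rightarrow> nat \<Rightarrow> complex" where
  "odd_min_term p y z j = z * p ^ j * qpoch_inf (- y * p ^ Suc j) p * qpoch_inf (- y * z * p ^ Suc j) p"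

text \<open>The product over \<open>i \<le> n\<close> is \<open>z^(n+1) p^(n(n+1)/2)\<close>, written without the division by 2.\<close>

definition psi_term :: "complex \<Rightarrow> complex \<Rightarrow> nat \<Rightarrow> complex" where
  "psi_term p z n = (- 1) ^ n * (\<Prod>i\<le>n. z * p ^ i) * (qpoch_inf (- p) p * qpoch_inf (- z * p ^ Suc n) p)"

section \<open>Geometric bounds, uniform in z, for the terms of both series\<close>

lemma norm_qpoch_inf_mult_le:
  assumes "norm p < 1" "norm a \<le> 1" "norm b \<le> 1"
  shows "norm (qpoch_inf a p * qpoch_inf b p) \<le> (exp (1 / (1 - norm p)))\<^sup>2"
  unfolding norm_mult power2_eq_square
  by (intro mult_mono norm_qpoch_inf_le assms) auto

lemma norm_times_power_le_1:
  fixes p z :: complex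
  assumes "norm p < 1" "norm z \<le> 1"
  shows "norm (z * p ^ n) \<le> 1"
  unfolding norm_mult norm_power using assms by (intro mult_le_one power_le_one) auto

lemma norm_odd_min_term_le:
  assumes p: "norm p < 1" and y: "norm y = 1" and z: "norm z \<le> 1"
  shows "norm (odd_min_term p y z j) \<le> norm p ^ j * (exp (1 / (1 - norm p)))\<^sup>2"
proof -
  have yz: "norm (- y * z) \<le> 1" "norm (- y) \<le> 1"
    using y z by (auto simp: norm_mult)
  have "norm (odd_min_term p y z j)
      = norm (z * p ^ j) * norm (qpoch_inf (- y * p ^ Suc j) p * qpoch_inf (- y * z * p ^ Suc j) p)"
    by (simp add: odd_min_term_def norm_mult mult.assoc)
  also have "\<dots> \<le> norm p ^ j * (exp (1 / (1 - norm p)))\<^sup>2"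
  proof (intro mult_mono norm_qpoch_inf_mult_le norm_times_power_le_1 p yz)
    show "norm (z * p ^ j) \<le> norm p ^ j"
      using z by (simp add: norm_mult norm_power mult_left_le_one_le)
  qed auto
  finally show ?thesis .
qed

lemma norm_psi_term_le:
  assumes p: "norm p < 1" and z: "norm z \<le> 1"
  shows "norm (psi_term p z n) \<le> norm p ^ n * (exp (1 / (1 - norm p)))\<^sup>2"
proof -
  have z': "norm (- z) \<le> 1"
    using z by simp
  \<comment> \<open>All factors have norm at most 1; keeping only the last one already gives the
    same geometric majorant as for \<open>odd_min_term\<close>.\<close>
  have pr: "norm (\<Prod>i\<le>n. z * p ^ i) \<le> norm p ^ n"
  proof (cases n)
    case (Suc m)
    have "norm (\<Prod>i<n. z * p ^ i) \<le> 1"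
      unfolding prod_norm[symmetric] by (intro prod_le_1) (use norm_times_power_le_1[OF p z] in auto)
    moreover have "norm (z * p ^ n) \<le> norm p ^ n"
      using z by (simp add: norm_mult norm_power mult_left_le_one_le)
    ultimately have "norm (\<Prod>i<n. z * p ^ i) * norm (z * p ^ n) \<le> 1 * norm p ^ n"
      by (intro mult_mono) auto
    then show ?thesis
      by (simp add: lessThan_Suc_atMost[symmetric] norm_mult)
  qed (use z in auto)
  have "norm (psi_term p z n)
      = norm (\<Prod>i\<le>n. z * p ^ i) * norm (qpoch_inf (- p) p * qpoch_inf (- z * p ^ Suc n) p)"
    by (simp add: psi_term_def norm_mult norm_power)
  also have "\<dots> \<le> norm p ^ n * (exp (1 / (1 - norm p)))\<^sup>2"
    by (intro mult_mono norm_qpoch_inf_mult_le norm_times_power_le_1 p z' pr) (use p in auto)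
  finally show ?thesis .
qed

lemma geometric_majorant:
  fixes f :: "nat \<Rightarrow> complex"
  assumes r: "0 \<le> r" "r < 1" and f: "\<And>n. norm (f n) \<le> r ^ n * K"
  shows "summable f" and "norm (suminf f) \<le> K / (1 - r)"
proof -
  have s: "summable (\<lambda>n. r ^ n * K)"
    using r by (intro summable_mult2 summable_geometric) auto
  show "summable f"
    by (rule summable_comparison_test'[OF s, of 0]) (use f in auto)
  have "norm (suminf f) \<le> (\<Sum>n. r ^ n * K)"
    by (rule norm_suminf_le[OF f s])
  also have "\<dots> = K / (1 - r)"
    using r by (simp add: suminf_mult2[symmetric] summable_geometric suminf_geometric)
  finally show "norm (suminf f) \<le> K / (1 - r)" .
qed

section \<open>Functional equations under the shift z -> zp\<close>

lemma odd_min_functional_equation: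
  assumes p: "norm p < 1" and y: "y\<^sup>2 = 1" and z: "norm z \<le> 1"
  shows "y * (suminf (odd_min_term p y z) + z * suminf (odd_min_term p y (z * p)))
       = z * (qpoch_inf (- y) p * qpoch_inf (- y * z * p) p - 1)"
proof -
  have ny: "norm y = 1"
    using y by (auto simp: power2_eq_1_iff)
  have zp: "norm (z * p) \<le> 1"
    using norm_times_power_le_1[OF p z, of 1] by simp
  have summ: "summable (odd_min_term p y w)" if "norm w \<le> 1" for w
    by (rule geometric_majorant(1)[OF _ p norm_odd_min_term_le[OF p ny that]]) auto
  \<comment> \<open>Passing from \<open>u j\<close> to \<open>u (Suc j)\<close> removes the factor 1
    + y p^j from the first product and 1 + y z p^(j+1) from the second.\<close>
  define u where "u j = qpoch_inf (- y * p ^ j) p * qpoch_inf (- y * z * p ^ Suc j) p" for j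
  have "(\<lambda>j. p ^ j) \<longlonglongrightarrow> 0"
    by (rule LIMSEQ_power_zero[OF p])
  then have "u \<longlonglongrightarrow> 1 * 1"
    unfolding u_def
    by (intro tendsto_mult qpoch_inf_tendsto_1 p tendsto_mult_right_zero LIMSEQ_Suc)
  then have "(\<lambda>j. u j - u (Suc j)) sums (u 0 - 1)"
    by (intro telescope_sums') simp
  then have 1: "(\<lambda>j. z * (u j - u (Suc j))) sums (z * (u 0 - 1))"
    by (rule sums_mult)
  have eq: "z * (u j - u (Suc j)) = y * (odd_min_term p y z j + z * odd_min_term p y (z * p) j)" for j
  proof -
    define A B where "A = qpoch_inf (- y * p ^ Suc j) p" and "B = qpoch_inf (- y * z * p ^ Suc (Suc j)) p"
    have a: "qpoch_inf (- y * p ^ j) p = (1 + y * p ^ j) * A"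
      by (subst qpoch_inf_step[OF p]) (simp add: A_def mult_ac)
    have b: "qpoch_inf (- y * z * p ^ Suc j) p = (1 + y * z * p ^ Suc j) * B"
      by (subst qpoch_inf_step[OF p]) (simp add: B_def mult_ac)
    have c: "qpoch_inf (- y * (z * p) * p ^ Suc j) p = B"
      by (simp add: B_def mult_ac)
    have yy: "y * y = 1"
      using y by (simp add: power2_eq_square)
    have "z * (u j - u (Suc j)) = z * ((1 + y * p ^ j) * (1 + y * z * p ^ Suc j) - 1) * (A * B)"
      unfolding u_def a b by (simp add: A_def B_def algebra_simps)
    \<comment> \<open>In the first summand the factor 1 + y z p^(j+1) completes \<open>B\<close> to
      the product in the term at z; the second summand gives the term at zp.\<close>
    also have "(1 + y * p ^ j) * (1 + y * z * p ^ Suc j) - 1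
        = y * p ^ j * (1 + y * z * p ^ Suc j) + y * z * p ^ Suc j"
      by (simp add: algebra_simps)
    also have "z * (y * p ^ j * (1 + y * z * p ^ Suc j) + y * z * p ^ Suc j) * (A * B)
        = y * (odd_min_term p y z j + z * odd_min_term p y (z * p) j)"
      unfolding odd_min_term_def b c A_def[symmetric] by (simp add: algebra_simps)
    finally show ?thesis .
  qed
  have 2: "(\<lambda>j. y * (odd_min_term p y z j + z * odd_min_term p y (z * p) j)) sums
      (y * (suminf (odd_min_term p y z) + z * suminf (odd_min_term p y (z * p))))"
    by (intro sums_mult sums_add summable_sums summ z zp)
  show ?thesis
    using sums_unique2[OF 1[unfolded eq] 2] by (simp add: u_def)
qed

text \<open>Term n+1 at z is -z times term n at zp, so the combination on the left leaves only the
  term n = 0 at z.\<close>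

lemma psi_functional_equation:
  assumes p: "norm p < 1" and z: "norm z \<le> 1"
  shows "suminf (psi_term p z) + z * suminf (psi_term p (z * p))
       = z * qpoch_inf (- p) p * qpoch_inf (- z * p) p"
proof -
  have zp: "norm (z * p) \<le> 1"
    using norm_times_power_le_1[OF p z, of 1] by simp
  have summ: "summable (psi_term p w)" if "norm w \<le> 1" for w
    by (rule geometric_majorant(1)[OF _ p norm_psi_term_le[OF p that]]) auto
  have eq: "psi_term p z (Suc n) = - z * psi_term p (z * p) n" for n
  proof -
    have "(\<Prod>i\<le>Suc n. z * p ^ i) = z * (\<Prod>i\<le>n. z * p * p ^ i)"
      by (subst prod.atMost_Suc_shift) (simp add: mult_ac)
    moreover have "- (z * p) * p ^ Suc n = - z * p ^ Suc (Suc n)"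
      by simp
    ultimately show ?thesis
      unfolding psi_term_def
      by (simp only: power_Suc)
        (simp only: mult_minus_left mult_minus_right mult_1_left mult.assoc mult.left_commute)
  qed
  have "suminf (psi_term p z) = psi_term p z 0 + (\<Sum>n. - z * psi_term p (z * p) n)"
    using suminf_split_head[OF summ[OF z]] by (simp add: eq)
  also have "(\<Sum>n. - z * psi_term p (z * p) n) = - z * suminf (psi_term p (z * p))"
    by (rule suminf_mult[OF summ[OF zp]])
  moreover have "psi_term p z 0 = z * qpoch_inf (- p) p * qpoch_inf (- z * p) p"
    by (simp add: psi_term_def)
  ultimately show ?thesis
    by simp
qed

text \<open>The difference of the two sides solves a homogeneous equation under z -> zp, and a
  bounded solution vanishes inside the unit disc.\<close>

lemma odd_min_terms_eq_psi_terms: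
  assumes p: "norm p < 1" and z: "norm z < 1"
  shows "suminf (odd_min_term p 1 z) + suminf (odd_min_term p (- 1) z) = 2 * suminf (psi_term p z)"
proof -
  define Y where "Y w = suminf (odd_min_term p 1 w) + suminf (odd_min_term p (- 1) w)
                          - 2 * suminf (psi_term p w)" for w
  define K where "K = (exp (1 / (1 - norm p)))\<^sup>2 / (1 - norm p)"
  have zn: "norm (z * p ^ n) \<le> 1" for n
    using norm_times_power_le_1[OF p] z by simp
  have step: "Y w = - w * Y (w * p)" if w: "norm w \<le> 1" for w
  proof -
    \<comment> \<open>The leading factor 1 - a is 2 at a = -1 and 0 at a = 1. Hence y = 1
      contributes z (2 E(-p) E(-zp) - 1) and y = -1 contributes z; their sum is twice the right-hand
      side of the equation for \<open>psi_term\<close>.\<close>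
    have m1: "qpoch_inf (- 1) p = 2 * qpoch_inf (- p) p"
      by (subst qpoch_inf_step[OF p]) simp
    have p1: "qpoch_inf 1 p = 0"
      by (subst qpoch_inf_step[OF p]) simp
    have "(suminf (odd_min_term p 1 w) + w * suminf (odd_min_term p 1 (w * p)))
        + (suminf (odd_min_term p (- 1) w) + w * suminf (odd_min_term p (- 1) (w * p)))
        = 2 * (suminf (psi_term p w) + w * suminf (psi_term p (w * p)))"
      unfolding psi_functional_equation[OF p w]
      using odd_min_functional_equation[OF p _ w, of 1] odd_min_functional_equation[OF p _ w, of "-1"]
      by (simp add: m1 p1 algebra_simps)
    then show ?thesis
      by (simp add: Y_def algebra_simps)
  qed
  have bound: "norm (Y w) \<le> 4 * K" if w: "norm w \<le> 1" for w
  proof -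
    have "norm (suminf (odd_min_term p y w)) \<le> K" if "norm y = 1" for y
      unfolding K_def by (rule geometric_majorant(2)[OF _ p norm_odd_min_term_le[OF p that w]]) auto
    from this[of 1] this[of "-1"]
    have 1: "norm (suminf (odd_min_term p 1 w)) \<le> K" "norm (suminf (odd_min_term p (- 1) w)) \<le> K"
      by auto
    have 2: "norm (suminf (psi_term p w)) \<le> K"
      unfolding K_def by (rule geometric_majorant(2)[OF _ p norm_psi_term_le[OF p w]]) auto
    have "norm (Y w) \<le> norm (suminf (odd_min_term p 1 w)) + norm (suminf (odd_min_term p (- 1) w))
        + norm (2 * suminf (psi_term p w))"
      unfolding Y_def by (meson norm_triangle_ineq4 norm_triangle_ineq order_trans add_right_mono)
    with 1 2 show ?thesis
      by (simp add: norm_mult)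
  qed
  \<comment> \<open>Each use of \<open>step\<close> at z p^n costs a factor of norm at most |z|,
    while \<open>bound\<close> is independent of n; thus |z| < 1 forces Y z = 0.\<close>
  have it: "norm (Y z) \<le> norm z ^ n * norm (Y (z * p ^ n))" for n
  proof (induction n)
    case (Suc n)
    have "norm (z * p ^ n) \<le> norm z"
      using p by (simp add: norm_mult norm_power mult_right_le_one_le power_le_one)
    then have "norm (Y (z * p ^ n)) \<le> norm z * norm (Y (z * p ^ Suc n))"
      unfolding step[OF zn, of n] by (simp add: norm_mult mult_right_mono mult.commute mult.left_commute)
    then have "norm z ^ n * norm (Y (z * p ^ n)) \<le> norm z ^ n * (norm z * norm (Y (z * p ^ Suc n)))"
      by (intro mult_left_mono) auto
    with Suc show ?case
      by (simp add: mult_ac)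
  qed simp
  have "norm (Y z) \<le> norm z ^ n * (4 * K)" for n
    by (rule order_trans[OF it mult_left_mono[OF bound[OF zn]]]) auto
  moreover have "(\<lambda>n. norm z ^ n * (4 * K)) \<longlonglongrightarrow> 0"
    using z by (intro tendsto_mult_left_zero LIMSEQ_realpow_zero) auto
  ultimately have "norm (Y z) \<le> 0"
    by (intro tendsto_lowerbound[of _ 0 sequentially]) auto
  then show ?thesis
    by (simp add: Y_def)
qed

section \<open>Generating functions of partitions into distinct parts\<close>

lemma prod_one_plus_eq_sum_Pow:
  fixes f :: "'a \<Rightarrow> 'b :: comm_semiring_1"
  assumes "finite A"
  shows "(\<Prod>x\<in>A. 1 + f x) = (\<Sum>X\<in>Pow A. \<Prod>x\<in>X. f x)"
  using prod_add[OF assms, of f "\<lambda>_. 1"] by (simp add: add.commute)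

text \<open>The partial product over k < N expands into the sum over the subsets of {..<N}. The
  bound exp of the sum of norms makes the whole family absolutely summable, so its sum is the limit
  of these partial sums.\<close>

lemma has_sum_prod_finite_subsets:
  fixes f :: "nat \<Rightarrow> complex"
  assumes f: "summable (\<lambda>k. norm (f k))"
  shows "((\<lambda>D. \<Prod>k\<in>D. f k) has_sum (\<Prod>k. 1 + f k)) {D. finite D}"
proof -
  have cover: "\<exists>N. F \<subseteq> Pow {..<N}" if "finite F" "F \<subseteq> {D. finite D}" for F :: "nat set set"
  proof -
    have "finite (\<Union>F)"
      using that by auto
    then obtain N where "\<Union>F \<subseteq> {..<N}"
      using finite_nat_bounded by blast
    then show ?thesis by auto
  qed
  have "(\<lambda>D. norm (\<Prod>k\<in>D. f k)) summable_on {D. finite D}"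
  proof (rule abs_summable_iff_bdd_above[THEN iffD2], rule bdd_aboveI2)
    fix F :: "nat set set" assume "F \<in> {F. F \<subseteq> {D. finite D} \<and> finite F}"
    then have F: "finite F" "F \<subseteq> {D. finite D}"
      by simp_all
    obtain N where N: "F \<subseteq> Pow {..<N}"
      using cover[OF F] by (elim exE)
    have "(\<Sum>D\<in>F. norm (\<Prod>k\<in>D. f k)) \<le> (\<Sum>D\<in>Pow {..<N}. \<Prod>k\<in>D. norm (f k))"
      unfolding prod_norm[symmetric] by (intro sum_mono2 N) (auto intro: prod_nonneg)
    also have "\<dots> = (\<Prod>k<N. 1 + norm (f k))"
      by (simp add: prod_one_plus_eq_sum_Pow)
    also have "\<dots> \<le> exp (\<Sum>k<N. norm (f k))"
      by (intro prod_le_exp_sum) auto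
    also have "\<dots> \<le> exp (\<Sum>k. norm (f k))"
      using f by (auto intro!: sum_le_suminf)
    finally show "(\<Sum>D\<in>F. norm (\<Prod>k\<in>D. f k)) \<le> exp (\<Sum>k. norm (f k))" .
  qed
  then have hs: "((\<lambda>D. \<Prod>k\<in>D. f k) has_sum (\<Sum>\<^sub>\<infinity>D\<in>{D. finite D}. \<Prod>k\<in>D. f k)) {D. finite D}"
    by (rule has_sum_infsum[OF abs_summable_summable])
  \<comment> \<open>By \<open>cover\<close> the families \<open>Pow {..<N}\<close> are cofinal among
    the finite families of finite sets, so the unordered sum may be evaluated along them.\<close>
  have "filterlim (\<lambda>N. Pow {..<N}) (finite_subsets_at_top {D::nat set. finite D}) sequentially"
    unfolding filterlim_iff eventually_finite_subsets_at_top
  proof (intro allI impI, elim exE conjE)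
    fix P and F :: "nat set set"
    assume F: "finite F" "F \<subseteq> {D. finite D}"
      and P: "\<forall>Y. finite Y \<and> F \<subseteq> Y \<and> Y \<subseteq> {D. finite D} \<longrightarrow> P Y"
    obtain N where N: "F \<subseteq> Pow {..<N}"
      using cover[OF F] by (elim exE)
    have "P (Pow {..<n})" if "N \<le> n" for n
    proof -
      have "F \<subseteq> Pow {..<n}"
        using N Pow_mono[of "{..<N}" "{..<n}"] that by auto
      then show ?thesis
        by (intro P[rule_format]) (auto intro: finite_subset)
    qed
    then show "\<forall>\<^sub>F n in sequentially. P (Pow {..<n})"
      by (auto simp: eventually_sequentially)
  qed
  from filterlim_compose[OF hs[unfolded has_sum_def] this]
  have "(\<lambda>N. \<Prod>k<N. 1 + f k) \<longlonglongrightarrow> (\<Sum>\<^sub>\<infinity>D\<in>{D. finite D}. \<Prod>k\<in>D. f k)"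
    by (simp add: prod_one_plus_eq_sum_Pow)
  moreover have "convergent_prod (\<lambda>k. 1 + f k)"
    using f by (intro abs_convergent_prod_imp_convergent_prod summable_imp_abs_convergent_prod) simp
  then have "(\<lambda>N. \<Prod>k<N. 1 + f k) \<longlonglongrightarrow> (\<Prod>k. 1 + f k)"
    by (simp add: LIMSEQ_lessThan_iff_atMost convergent_prod_LIMSEQ)
  ultimately show ?thesis
    using hs LIMSEQ_unique by metis
qed

lemma has_sum_finite_sets_qpoch_inf:
  assumes "norm q < 1"
  shows "((\<lambda>D. \<Prod>k\<in>D. a * q ^ k) has_sum qpoch_inf (- a) q) {D. finite D}"
  using has_sum_prod_finite_subsets[of "\<lambda>k. a * q ^ k"] assms
  by (simp add: qpoch_inf_def norm_mult norm_power summable_mult summable_geometric)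

section \<open>Splitting a set of distinct parts at its smallest part\<close>

lemma prod_mult_power_eq:
  fixes y q :: complex
  shows "(\<Prod>k\<in>D. y * q ^ k) = y ^ card D * q ^ \<Sum>D"
  by (simp add: prod.distrib power_sum)

text \<open>The elements above the minimum 2j+1 are at least 2j+2. Subtracting 2j+2 from them leaves
  an arbitrary finite set, possibly containing 0, to which the product expansion applies.\<close>

lemma bij_betw_insert_min:
  "bij_betw (\<lambda>(j, D). insert (2 * j + 1) ((+) (2 * j + 2) ` D))
     (UNIV \<times> {D. finite D}) {D :: nat set. finite D \<and> D \<noteq> {} \<and> odd (Min D)}"
  (is "bij_betw ?h ?A ?B")
  unfolding bij_betw_def
proof
  have min: "Min (insert (2 * j + 1) ((+) (2 * j + 2) ` D)) = 2 * j + 1" if "finite D" for j and D :: "nat set"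
    using that by (intro Min_eqI) auto
  \<comment> \<open>The minimum 2j+1 lies below the shift 2j+2, so undoing the shift recovers
    exactly \<open>D\<close>.\<close>
  have tail: "{k. k + (2 * j + 2) \<in> insert (2 * j + 1) ((+) (2 * j + 2) ` D)} = D" for j and D :: "nat set"
    by auto
  show "inj_on ?h ?A"
  proof (rule inj_onI, clarify)
    fix j j' and D D' :: "nat set"
    assume fin: "finite D" "finite D'"
      and eq: "insert (2 * j + 1) ((+) (2 * j + 2) ` D) = insert (2 * j' + 1) ((+) (2 * j' + 2) ` D')"
    from arg_cong[OF eq, of Min] have "j = j'"
      by (simp only: min[OF fin(1)] min[OF fin(2)])
    moreover have "D = D'"
      using arg_cong[OF eq, of "\<lambda>X. {k. k + (2 * j + 2) \<in> X}"] unfolding \<open>j = j'\<close> tail .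
    ultimately show "j = j' \<and> D = D'" by simp
  qed
  show "?h ` ?A = ?B"
  proof (intro equalityI subsetI)
    fix X assume "X \<in> ?h ` ?A"
    then show "X \<in> ?B" using min by auto
  next
    fix X assume "X \<in> ?B"
    then obtain j where X: "finite X" "X \<noteq> {}" and j: "Min X = 2 * j + 1"
      by (auto elim: oddE)
    define D where "D = {k. k + (2 * j + 2) \<in> X}"
    have "finite D"
      unfolding D_def using finite_vimageI[OF X(1), of "\<lambda>k. k + (2 * j + 2)"]
      by (simp add: vimage_def inj_def)
    have "X = insert (2 * j + 1) ((+) (2 * j + 2) ` D)"
    proof (intro equalityI subsetI)
      fix x assume x: "x \<in> X"
      then have "2 * j + 1 \<le> x"
        using Min_le[OF X(1) x] j by simp
      show "x \<in> insert (2 * j + 1) ((+) (2 * j + 2) ` D)"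
      proof (cases "x = 2 * j + 1")
        case False
        with \<open>2 * j + 1 \<le> x\<close> have e: "x = (2 * j + 2) + (x - (2 * j + 2))"
          by simp
        have "x - (2 * j + 2) \<in> D"
          unfolding D_def mem_Collect_eq using x by (subst add.commute, subst e[symmetric])
        then have "(2 * j + 2) + (x - (2 * j + 2)) \<in> (+) (2 * j + 2) ` D"
          by (rule imageI)
        then show ?thesis
          unfolding e[symmetric] by simp
      qed simp
    next
      fix x assume "x \<in> insert (2 * j + 1) ((+) (2 * j + 2) ` D)"
      then show "x \<in> X"
        using Min_in[OF X] j by (auto simp: D_def add.commute)
    qed
    with \<open>finite D\<close> show "X \<in> ?h ` ?A"
      by (intro image_eqI[where x = "(j, D)"]) auto
  qed
qed

lemma has_sum_odd_min_sets:
  assumes q: "norm q < 1"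
  shows "((\<lambda>D. y ^ card D * q ^ \<Sum>D) has_sum y * suminf (odd_min_term (q\<^sup>2) y q))
           {D. finite D \<and> D \<noteq> {} \<and> odd (Min D)}"
proof -
  let ?B = "{D :: nat set. finite D \<and> D \<noteq> {} \<and> odd (Min D)}"
  let ?w = "\<lambda>D. \<Prod>k\<in>D. y * q ^ k"
  \<comment> \<open>Only the existence of the sum is inherited from the family of all finite sets;
    its value \<open>S\<close> is found by fixing j and summing over the tails first.\<close>
  have "?w summable_on ?B"
    by (rule summable_on_subset_banach[OF has_sum_imp_summable[OF has_sum_finite_sets_qpoch_inf[OF q]]]) auto
  then obtain S where S: "(?w has_sum S) ?B"
    by (auto simp: summable_on_def)
  let ?h = "\<lambda>(j, D). insert (2 * j + 1) ((+) (2 * j + 2) ` D)"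
  have split: "?w (?h (j, D)) = y * q ^ (2 * j + 1) * (\<Prod>k\<in>D. (y * q ^ (2 * j + 2)) * q ^ k)"
    if "finite D" for j D
  proof -
    have "?w (?h (j, D)) = y * q ^ (2 * j + 1) * ?w ((+) (2 * j + 2) ` D)"
      using that by (auto simp: prod.insert_if)
    also have "?w ((+) (2 * j + 2) ` D) = (\<Prod>k\<in>D. (y * q ^ (2 * j + 2)) * q ^ k)"
      by (subst prod.reindex) (simp_all only: inj_on_add o_def power_add mult.assoc)
    finally show ?thesis .
  qed
  have "((\<lambda>x. ?w (?h x)) has_sum S) (UNIV \<times> {D. finite D})"
    using S by (subst has_sum_reindex_bij_betw[OF bij_betw_insert_min])
  moreover have "((\<lambda>D. ?w (?h (j, D))) has_sum y * q ^ (2 * j + 1) * qpoch_inf (- (y * q ^ (2 * j + 2))) q)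
      {D. finite D}" for j
  proof (rule has_sum_cong[THEN iffD2])
    show "?w (?h (j, D)) = y * q ^ (2 * j + 1) * (\<Prod>k\<in>D. (y * q ^ (2 * j + 2)) * q ^ k)"
      if "D \<in> {D. finite D}" for D
      using that by (intro split) simp
    show "((\<lambda>D. y * q ^ (2 * j + 1) * (\<Prod>k\<in>D. (y * q ^ (2 * j + 2)) * q ^ k)) has_sum
        y * q ^ (2 * j + 1) * qpoch_inf (- (y * q ^ (2 * j + 2))) q) {D. finite D}"
      by (intro has_sum_cmult_right has_sum_finite_sets_qpoch_inf q)
  qed
  ultimately have "((\<lambda>j. y * q ^ (2 * j + 1) * qpoch_inf (- (y * q ^ (2 * j + 2))) q) has_sum S) UNIV"
    by (rule has_sum_SigmaD)
  then have "(\<lambda>j. y * q ^ (2 * j + 1) * qpoch_inf (- (y * q ^ (2 * j + 2))) q) sums S"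
    by (rule has_sum_imp_sums)
  moreover have "y * q ^ (2 * j + 1) * qpoch_inf (- (y * q ^ (2 * j + 2))) q = y * odd_min_term (q\<^sup>2) y q j" for j
  proof -
    \<comment> \<open>The even and odd factors of the base q product at -y q^(2j+2) are the two
      products in \<open>odd_min_term\<close> for p = q^2.\<close>
    have pw: "q ^ (2 * j + 1) = q * (q\<^sup>2) ^ j" "q ^ (2 * j + 2) = (q\<^sup>2) ^ Suc j"
      by (simp_all add: power_mult power_add power2_eq_square)
    have ar: "- (y * (q\<^sup>2) ^ Suc j) = - y * (q\<^sup>2) ^ Suc j"
      "- y * (q\<^sup>2) ^ Suc j * q = - y * q * (q\<^sup>2) ^ Suc j"
      by simp_all
    show ?thesis
      unfolding odd_min_term_def pw
      unfolding qpoch_inf_even_odd[OF q, of "- (y * (q\<^sup>2) ^ Suc j)"]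
      unfolding ar by (simp only: mult.assoc)
  qed
  ultimately have s: "(\<lambda>j. y * odd_min_term (q\<^sup>2) y q j) sums S"
    by (simp only:)
  have "S = y * suminf (odd_min_term (q\<^sup>2) y q)"
  \<comment> \<open>For nonzero y, summability of \<open>odd_min_term\<close> follows by cancelling
    y; for y = 0 both sides are 0.\<close>
  proof (cases "y = 0")
    case False
    then show ?thesis
      using s by (metis sums_summable sums_unique suminf_mult summable_mult_D)
  qed (use s sums_unique2[OF s, of 0] in simp)
  moreover have "(?w has_sum S) ?B \<longleftrightarrow> ((\<lambda>D. y ^ card D * q ^ \<Sum>D) has_sum S) ?B"
    by (intro has_sum_cong) (simp add: prod_mult_power_eq)
  ultimately show ?thesis
    using S by (simp only:)
qed

section \<open>Comparison with the partition numbers and with the mock theta series\<close>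

lemma p_do_odd_eq_card:
  "p_do_odd n = card {D. finite D \<and> odd (card D) \<and> odd (Min D) \<and> \<Sum>D = n}"
proof -
  have "bij_betw mset_set {D. finite D \<and> odd (card D) \<and> odd (Min D) \<and> \<Sum>D = n}
     {M. partition_of M n \<and> distinct_parts M \<and> odd (size M) \<and> odd (Min (set_mset M))}"
    (is "bij_betw _ ?S ?T")
  proof (rule bij_betwI[where g = set_mset])
    show "mset_set \<in> ?S \<rightarrow> ?T"
    proof (intro Pi_I)
      fix D assume D: "D \<in> ?S"
      \<comment> \<open>An odd minimum excludes 0 from \<open>D\<close>, so positivity of the parts
        comes for free.\<close>
      then have "Min D \<le> 0" if "0 \<in> D"
        using that D by (intro Min_le) auto
      then have "0 \<notin> D"
        using D by auto
      with D show "mset_set D \<in> ?T"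
        by (auto simp: partition_of_def distinct_parts_def count_mset_set' sum_unfold_sum_mset)
    qed
    have inverse: "mset_set (set_mset M) = M" if "distinct_parts M" for M
    proof (rule multiset_eqI)
      fix k
      show "count (mset_set (set_mset M)) k = count M k"
        using that[unfolded distinct_parts_def, rule_format, of k] count_greater_zero_iff[of M k]
        by (cases "k \<in># M") (auto simp: count_mset_set' not_in_iff simp del: count_greater_zero_iff)
    qed
    then show "\<And>M. M \<in> ?T \<Longrightarrow> mset_set (set_mset M) = M"
      by auto
    show "set_mset \<in> ?T \<rightarrow> ?S"
    proof (intro Pi_I)
      fix M assume M: "M \<in> ?T"
      then have "card (set_mset M) = size M" "\<Sum>(set_mset M) = sum_mset M"
        using inverse[of M] size_mset_set[of "set_mset M"] by (simp_all add: sum_unfold_sum_mset)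
      with M show "set_mset M \<in> ?S"
        by (auto simp: partition_of_def)
    qed
  qed auto
  then show ?thesis
    unfolding p_do_odd_def by (rule bij_betw_same_card[symmetric])
qed

lemma sums_p_do_odd:
  assumes "norm q < 1"
    and S: "((\<lambda>D. q ^ \<Sum>D) has_sum S) {D. finite D \<and> odd (card D) \<and> odd (Min D)}"
  shows "(\<lambda>n. of_nat (p_do_odd (Suc n)) * q ^ Suc n) sums S"
proof -
  let ?R = "\<lambda>n::nat. {D. finite D \<and> odd (card D) \<and> odd (Min D) \<and> \<Sum>D = n}"
  have "bij_betw snd (SIGMA n:UNIV. ?R n) {D. finite D \<and> odd (card D) \<and> odd (Min D)}"
    by (auto simp: bij_betw_def inj_on_def image_iff)
  then have "((\<lambda>x. q ^ \<Sum>(snd x)) has_sum S) (SIGMA n:UNIV. ?R n)"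
    using S by (subst has_sum_reindex_bij_betw)
  moreover have "((\<lambda>D. q ^ \<Sum>(snd (n, D))) has_sum of_nat (p_do_odd n) * q ^ n) (?R n)" for n
  proof (rule has_sum_finiteI)
    \<comment> \<open>Each element is bounded by the total n, so every fibre of the sum map is
      finite.\<close>
    have "?R n \<subseteq> Pow {..n}"
      using member_le_sum[of _ _ "\<lambda>x. x"] by fastforce
    then show "finite (?R n)"
      by (rule finite_subset) simp
    show "of_nat (p_do_odd n) * q ^ n = (\<Sum>D\<in>?R n. q ^ \<Sum>(snd (n, D)))"
      by (simp add: p_do_odd_eq_card)
  qed
  ultimately have "((\<lambda>n. of_nat (p_do_odd n) * q ^ n) has_sum S) UNIV"
    by (rule has_sum_SigmaD)
  then have "(\<lambda>n. of_nat (p_do_odd n) * q ^ n) sums S"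
    by (rule has_sum_imp_sums)
  \<comment> \<open>This permits starting the series at exponent 1: the only nonempty set with sum 0
    is {0}, whose minimum is even.\<close>
  moreover have "p_do_odd 0 = 0"
  proof -
    have empty: "?R 0 = {}"
    proof (rule equals0I, elim CollectE conjE)
      fix D :: "nat set" assume D: "finite D" "odd (card D)" "odd (Min D)" "\<Sum>D = 0"
      then have "\<forall>x\<in>D. x = 0" "D \<noteq> {}"
        by auto
      then have "D = {0}" by auto
      with D show False by simp
    qed
    show ?thesis
      unfolding p_do_odd_eq_card empty by simp
  qed
  ultimately show ?thesis
    using sums_Suc_iff[of "\<lambda>n. of_nat (p_do_odd n) * q ^ n" S] by (simp del: power_Suc)
qed

text \<open>The weight (1 - (-1)^card D)/2 selects odd cardinality, so half the difference of the
  generating functions for y = 1 and y = -1 is needed. The prefactor y turns this difference into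
  the sum of the two \<open>odd_min_term\<close> series.\<close>

lemma has_sum_odd_card_odd_min:
  assumes q: "norm q < 1"
  shows "((\<lambda>D. q ^ \<Sum>D) has_sum suminf (psi_term (q\<^sup>2) q))
           {D. finite D \<and> odd (card D) \<and> odd (Min D)}"
proof -
  let ?B = "{D :: nat set. finite D \<and> D \<noteq> {} \<and> odd (Min D)}"
  have q2: "norm (q\<^sup>2) < 1"
    using q by (simp add: norm_power power_less_one_iff)
  have "((\<lambda>D. (1 / 2) * (1 ^ card D * q ^ \<Sum>D + - ((- 1) ^ card D * q ^ \<Sum>D))) has_sum
      (1 / 2) * (1 * suminf (odd_min_term (q\<^sup>2) 1 q) + - (- 1 * suminf (odd_min_term (q\<^sup>2) (- 1) q)))) ?B"
    by (intro has_sum_cmult_right has_sum_add has_sum_uminusI has_sum_odd_min_sets q)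
  also have "(1 / 2) * (1 * suminf (odd_min_term (q\<^sup>2) 1 q) + - (- 1 * suminf (odd_min_term (q\<^sup>2) (- 1) q)))
      = suminf (psi_term (q\<^sup>2) q)"
    using odd_min_terms_eq_psi_terms[OF q2 q] by simp
  finally show ?thesis
    by (rule has_sum_cong_neutral[THEN iffD1, rotated -1]) (auto simp: card_gt_0_iff)
qed

text \<open>Termwise, the denominator cancels the first n+1 odd-exponent factors of (-q;q)_inf. What
  remains is the pair of products in \<open>psi_term\<close> for p = q^2 and z = q.\<close>

lemma qpoch_inf_times_mock_psi:
  assumes q: "norm q < 1"
  shows "qpoch_inf (- q) q * mock_psi (- q) = - suminf (psi_term (q\<^sup>2) q)"
proof -
  have q2: "norm (q\<^sup>2) < 1"
    using q by (simp add: norm_power power_less_one_iff)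
  have nz: "qpoch_inf (- q) q \<noteq> 0"
    using q by (intro qpoch_inf_nonzero) auto
  have summ: "summable (psi_term (q\<^sup>2) q)"
    by (rule geometric_majorant(1)[OF _ q2 norm_psi_term_le[OF q2]]) (use q in auto)
  \<comment> \<open>The exponents are 1, 3, ..., 2n+1, with sum (n+1)^2.\<close>
  have sq: "(\<Prod>i\<le>n. q * (q\<^sup>2) ^ i) = q ^ (Suc n)\<^sup>2" for n
  proof (induction n)
    case (Suc n)
    have "(Suc (Suc n))\<^sup>2 = (Suc n)\<^sup>2 + (2 * Suc n + 1)"
      by (simp add: power2_eq_square)
    with Suc show ?case
      by (simp only: prod.atMost_Suc power_add power_mult) simp
  qed simp
  have "qpoch_inf (- q) q * ((- q) ^ (Suc n)\<^sup>2 / qpoch (- q) (q\<^sup>2) (Suc n)) = - psi_term (q\<^sup>2) q n" for n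
  proof -
    have fac: "qpoch_inf (- q) q = qpoch (- q) (q\<^sup>2) (Suc n) * qpoch_inf (- q * (q\<^sup>2) ^ Suc n) (q\<^sup>2)
        * qpoch_inf (- q\<^sup>2) (q\<^sup>2)"
      by (subst qpoch_inf_even_odd[OF q], subst qpoch_inf_split[OF q2, of "- q" "Suc n"])
        (simp add: power2_eq_square)
    have "qpoch (- q) (q\<^sup>2) (Suc n) \<noteq> 0"
      using nz fac by auto
    \<comment> \<open>The square (n+1)^2 has the parity of n+1, which produces the overall minus
      sign.\<close>
    moreover have "(- q) ^ (Suc n)\<^sup>2 = - ((- 1) ^ n * q ^ (Suc n)\<^sup>2)"
      by (subst power_minus) (simp add: minus_one_power_iff)
    ultimately show ?thesis
      unfolding psi_term_def sq fac by (simp add: mult_ac)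
  qed
  \<comment> \<open>Dividing by the nonzero infinite product writes each summand as a constant times
    \<open>psi_term\<close>, whose summability is known.\<close>
  then have eq: "(- q) ^ (Suc n)\<^sup>2 / qpoch (- q) (q\<^sup>2) (Suc n)
      = - inverse (qpoch_inf (- q) q) * psi_term (q\<^sup>2) q n" for n
    using nz by (simp add: field_simps)
  have "mock_psi (- q) = - inverse (qpoch_inf (- q) q) * suminf (psi_term (q\<^sup>2) q)"
    unfolding mock_psi_def power2_minus eq by (rule suminf_mult[OF summ])
  with nz show ?thesis by simp
qed

theorem theorem1p6:
  fixes q :: complex
  assumes "norm q < 1"
  shows "qpoch_inf (- q) q * mock_psi (- q)
           = - (\<Sum>n. of_nat (p_do_odd (Suc n)) * q ^ Suc n)"
  using qpoch_inf_times_mock_psi[OF assms]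
    sums_unique[OF sums_p_do_odd[OF assms has_sum_odd_card_odd_min[OF assms]]]
  by simp

end
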